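(* If $\Psi=\Psi(s,t)$ is a solution of the Betchov-Da Rios equation $\Psi_t=\Psi_s\times\Psi_{ss}\times\Psi_{sss}$ in $E^4$ (with unit speed $s$-parameter curves), then, according to the parallel transport frame field, the Gaussian torsion of the soliton surface $\Psi=\Psi(s,t)$ is $$K_N=\frac{(Q^2\mathcal{W}^2-\mathcal{A})\,\mathcal{C}}{\mathcal{W}^4}.$$
   Context: Setting. $E^4$ is $\mathbb{R}^4$ with its standard inner product $\langle\cdot,\cdot\rangle$ and orientation; the ternary vector product $x\times y\times z$ is the formal determinant of the $4\times4$ matrix whose first row is the standard basis $(e_1,e_2,e_3,e_4)$ and whose remaining rows are $x,y,z$. Subscripts $s,t$ denote partial derivatives. $\Psi=\Psi(s,t)$ is a smooth map from a product of two open intervals to $E^4$ whose $s$-parameter curves $s\mapsto\Psi(s,t)$ are unit speed for all $t$. A parallel transport frame field is a smooth positively oriented orthonormal frame $\{\mathcal{T},\mathcal{P}_1,\mathcal{P}_2,\mathcal{P}_3\}$ along $\Psi$ with $\mathcal{T}=\Psi_s$, $\mathcal{T}_s=k_1\mathcal{P}_1+k_2\mathcal{P}_2+k_3\mathcal{P}_3$ and $(\mathcal{P}_i)_s=-k_i\mathcal{T}$; $k_1,k_2,k_3$ are its curvature functions. Put $\mathfrak{a}_{23}=\langle(\mathcal{P}_1)_t,\mathcal{P}_2\rangle$, $\mathfrak{a}_{24}=\langle(\mathcal{P}_1)_t,\mathcal{P}_3\rangle$, $\mathfrak{a}_{34}=\langle(\mathcal{P}_2)_t,\mathcal{P}_3\rangle$,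 $P=k_3(k_2)_s-k_2(k_3)_s$, $R=k_1(k_3)_s-k_3(k_1)_s$, $S=k_2(k_1)_s-k_1(k_2)_s$, $Q=\sqrt{k_1^2+k_2^2+k_3^2}$, $\mathcal{W}=\sqrt{P^2+R^2+S^2}$, and $\mathcal{A}=(Pk_3-Sk_1)\mathfrak{a}_{24}+(Pk_2-Rk_1)\mathfrak{a}_{23}+(Rk_3-Sk_2)\mathfrak{a}_{34}-R(k_2)_t-S(k_3)_t-P(k_1)_t$, $\mathcal{C}=(k_1)_sP_s+(k_2)_sR_s+(k_3)_sS_s$. Standing assumptions: at least two of $k_1,k_2,k_3$ are non-zero, and $P,R,S$ are not all zero at any point. Gaussian torsion (normal curvature function). Let $g_{11}=\langle\Psi_s,\Psi_s\rangle$, $g_{12}=\langle\Psi_s,\Psi_t\rangle$, $g_{22}=\langle\Psi_t,\Psi_t\rangle$ (so that $\mathcal{W}=\sqrt{g_{11}g_{22}-g_{12}^2}$). The orthonormal normal frame used is $N_1=\frac{1}{Q}(k_1\mathcal{P}_1+k_2\mathcal{P}_2+k_3\mathcal{P}_3)$, $N_2=\frac{1}{Q\mathcal{W}}\big((k_2S-k_3R)\mathcal{P}_1+(k_3P-k_1S)\mathcal{P}_2+(k_1R-k_2P)\mathcal{P}_3\big)$. Let $c_{11}^i=\langle\Psi_{ss},N_i\rangle$, $c_{12}^i=\langle\Psi_{st},N_i\rangle$, $c_{22}^i=\langle\Psi_{tt},N_i\rangle$. Then $$K_N=\frac{g_{11}(c_{12}^1c_{22}^2-c_{12}^2c_{22}^1)-g_{12}(c_{11}^1c_{22}^2-c_{11}^2c_{22}^1)+g_{22}(c_{11}^1c_{12}^2-c_{11}^2c_{12}^1)}{\mathcal{W}^3}.$$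 *)

theory Defs
  imports "HOL-Analysis.Analysis"
begin

text \<open>
  A map of the two parameters \<open>s\<close>, \<open>t\<close> is a curried function \<open>real \<Rightarrow> real \<Rightarrow> 'a\<close>.
  The two-sided derivatives below are only meaningful at interior points of the domain;
  all domains considered here are open.
\<close>

definition ds :: "(real \<Rightarrow> real \<Rightarrow> 'a::real_normed_vector) \<Rightarrow> real \<Rightarrow> real \<Rightarrow> 'a"
  where "ds f s t = vector_derivative (\<lambda>x. f x t) (at s)"

definition dt :: "(real \<Rightarrow> real \<Rightarrow> 'a::real_normed_vector) \<Rightarrow> real \<Rightarrow> real \<Rightarrow> 'a"
  where "dt f s t = vector_derivative (\<lambda>y. f s y) (at t)"

text \<open>
  \<open>C\<^sup>n\<close> on an open set: all iterated partial derivatives up to order \<open>n\<close> exist, and those of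
  order \<open>n\<close> are continuous (which forces continuity of those of lower order).
\<close>

primrec Ck_on :: "nat \<Rightarrow> (real \<times> real) set \<Rightarrow> (real \<Rightarrow> real \<Rightarrow> 'a::real_normed_vector) \<Rightarrow> bool" where
  "Ck_on 0 U f \<longleftrightarrow> continuous_on U (\<lambda>(s, t). f s t)"
| "Ck_on (Suc n) U f \<longleftrightarrow>
     (\<forall>(s, t)\<in>U. (\<lambda>x. f x t) differentiable (at s) \<and> (\<lambda>y. f s y) differentiable (at t)) \<and>
     Ck_on n U (ds f) \<and> Ck_on n U (dt f)"

definition smooth_on2 :: "(real \<times> real) set \<Rightarrow> (real \<Rightarrow> real \<Rightarrow> 'a::real_normed_vector) \<Rightarrow> bool"
  where "smooth_on2 U f \<longleftrightarrow> (\<forall>n. Ck_on n U f)"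

text \<open>
  The formal determinant with first row \<open>(e\<^sub>1, e\<^sub>2, e\<^sub>3, e\<^sub>4)\<close>: its \<open>i\<close>-th component is obtained by
  replacing each \<open>e\<^sub>j\<close> in that row by its own \<open>i\<close>-th component, so that the first row becomes \<open>e\<^sub>i\<close>.
\<close>

definition cross4 :: "real^4 \<Rightarrow> real^4 \<Rightarrow> real^4 \<Rightarrow> real^4"
  where "cross4 x y z = (\<chi> i. det (vector [axis i 1, x, y, z] :: real^4^4))"

definition unit_speed_s :: "(real \<times> real) set \<Rightarrow> (real \<Rightarrow> real \<Rightarrow> real^4) \<Rightarrow> bool"
  where "unit_speed_s U \<Psi> \<longleftrightarrow> (\<forall>(s, t)\<in>U. norm (ds \<Psi> s t) = 1)"

definition betchov_da_rios :: "(real \<times> real) set \<Rightarrow> (real \<Rightarrow> real \<Rightarrow> real^4) \<Rightarrow> bool"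
  where "betchov_da_rios U \<Psi> \<longleftrightarrow>
    (\<forall>(s, t)\<in>U. dt \<Psi> s t = cross4 (ds \<Psi> s t) (ds (ds \<Psi>) s t) (ds (ds (ds \<Psi>)) s t))"

definition positive_orthonormal :: "real^4 \<Rightarrow> real^4 \<Rightarrow> real^4 \<Rightarrow> real^4 \<Rightarrow> bool"
  where "positive_orthonormal u v w x \<longleftrightarrow>
    norm u = 1 \<and> norm v = 1 \<and> norm w = 1 \<and> norm x = 1 \<and>
    u \<bullet> v = 0 \<and> u \<bullet> w = 0 \<and> u \<bullet> x = 0 \<and> v \<bullet> w = 0 \<and> v \<bullet> x = 0 \<and> w \<bullet> x = 0 \<and>
    det (vector [u, v, w, x] :: real^4^4) > 0"

text \<open>
  No smoothness is demanded of the curvature functions: on an open set \<open>k\<^sub>i = \<langle>T\<^sub>s, P\<^sub>i\<rangle>\<close> is smooth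
  because the frame is.
\<close>

definition parallel_transport_frame ::
  "(real \<times> real) set \<Rightarrow> (real \<Rightarrow> real \<Rightarrow> real^4) \<Rightarrow>
   (real \<Rightarrow> real \<Rightarrow> real^4) \<Rightarrow> (real \<Rightarrow> real \<Rightarrow> real^4) \<Rightarrow> (real \<Rightarrow> real \<Rightarrow> real^4) \<Rightarrow> (real \<Rightarrow> real \<Rightarrow> real^4) \<Rightarrow>
   (real \<Rightarrow> real \<Rightarrow> real) \<Rightarrow> (real \<Rightarrow> real \<Rightarrow> real) \<Rightarrow> (real \<Rightarrow> real \<Rightarrow> real) \<Rightarrow> bool"
  where "parallel_transport_frame U \<Psi> T P1 P2 P3 k1 k2 k3 \<longleftrightarrow>
    smooth_on2 U T \<and> smooth_on2 U P1 \<and> smooth_on2 U P2 \<and> smooth_on2 U P3 \<and>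
    (\<forall>(s, t)\<in>U.
       positive_orthonormal (T s t) (P1 s t) (P2 s t) (P3 s t) \<and>
       T s t = ds \<Psi> s t \<and>
       ds T s t = k1 s t *\<^sub>R P1 s t + k2 s t *\<^sub>R P2 s t + k3 s t *\<^sub>R P3 s t \<and>
       ds P1 s t = - k1 s t *\<^sub>R T s t \<and>
       ds P2 s t = - k2 s t *\<^sub>R T s t \<and>
       ds P3 s t = - k3 s t *\<^sub>R T s t)"

definition not_identically_zero_on :: "(real \<times> real) set \<Rightarrow> (real \<Rightarrow> real \<Rightarrow> real) \<Rightarrow> bool"
  where "not_identically_zero_on U f \<longleftrightarrow> (\<exists>(s, t)\<in>U. f s t \<noteq> 0)"

definition at_least_two_nonzero ::
  "(real \<times> real) set \<Rightarrow> (real \<Rightarrow> real \<Rightarrow> real) \<Rightarrow> (real \<Rightarrow> real \<Rightarrow> real) \<Rightarrow> (real \<Rightarrow> real \<Rightarrow> real) \<Rightarrow> bool"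
  where "at_least_two_nonzero U f g h \<longleftrightarrow>
    not_identically_zero_on U f \<and> not_identically_zero_on U g \<or>
    not_identically_zero_on U f \<and> not_identically_zero_on U h \<or>
    not_identically_zero_on U g \<and> not_identically_zero_on U h"

definition fP ::
  "(real \<Rightarrow> real \<Rightarrow> real) \<Rightarrow> (real \<Rightarrow> real \<Rightarrow> real) \<Rightarrow> (real \<Rightarrow> real \<Rightarrow> real) \<Rightarrow> real \<Rightarrow> real \<Rightarrow> real"
  where "fP k1 k2 k3 s t = k3 s t * ds k2 s t - k2 s t * ds k3 s t"

definition fR ::
  "(real \<Rightarrow> real \<Rightarrow> real) \<Rightarrow> (real \<Rightarrow> real \<Rightarrow> real) \<Rightarrow> (real \<Rightarrow> real \<Rightarrow> real) \<Rightarrow> real \<Rightarrow> real \<Rightarrow> real"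
  where "fR k1 k2 k3 s t = k1 s t * ds k3 s t - k3 s t * ds k1 s t"

definition fS ::
  "(real \<Rightarrow> real \<Rightarrow> real) \<Rightarrow> (real \<Rightarrow> real \<Rightarrow> real) \<Rightarrow> (real \<Rightarrow> real \<Rightarrow> real) \<Rightarrow> real \<Rightarrow> real \<Rightarrow> real"
  where "fS k1 k2 k3 s t = k2 s t * ds k1 s t - k1 s t * ds k2 s t"

definition fQ ::
  "(real \<Rightarrow> real \<Rightarrow> real) \<Rightarrow> (real \<Rightarrow> real \<Rightarrow> real) \<Rightarrow> (real \<Rightarrow> real \<Rightarrow> real) \<Rightarrow> real \<Rightarrow> real \<Rightarrow> real"
  where "fQ k1 k2 k3 s t = sqrt ((k1 s t)\<^sup>2 + (k2 s t)\<^sup>2 + (k3 s t)\<^sup>2)"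

definition fW ::
  "(real \<Rightarrow> real \<Rightarrow> real) \<Rightarrow> (real \<Rightarrow> real \<Rightarrow> real) \<Rightarrow> (real \<Rightarrow> real \<Rightarrow> real) \<Rightarrow> real \<Rightarrow> real \<Rightarrow> real"
  where "fW k1 k2 k3 s t = sqrt ((fP k1 k2 k3 s t)\<^sup>2 + (fR k1 k2 k3 s t)\<^sup>2 + (fS k1 k2 k3 s t)\<^sup>2)"

definition fC ::
  "(real \<Rightarrow> real \<Rightarrow> real) \<Rightarrow> (real \<Rightarrow> real \<Rightarrow> real) \<Rightarrow> (real \<Rightarrow> real \<Rightarrow> real) \<Rightarrow> real \<Rightarrow> real \<Rightarrow> real"
  where "fC k1 k2 k3 s t =
    ds k1 s t * ds (fP k1 k2 k3) s t + ds k2 s t * ds (fR k1 k2 k3) s t + ds k3 s t * ds (fS k1 k2 k3) s t"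

definition fA ::
  "(real \<Rightarrow> real \<Rightarrow> real) \<Rightarrow> (real \<Rightarrow> real \<Rightarrow> real) \<Rightarrow> (real \<Rightarrow> real \<Rightarrow> real) \<Rightarrow>
   (real \<Rightarrow> real \<Rightarrow> real^4) \<Rightarrow> (real \<Rightarrow> real \<Rightarrow> real^4) \<Rightarrow> (real \<Rightarrow> real \<Rightarrow> real^4) \<Rightarrow> real \<Rightarrow> real \<Rightarrow> real"
  where "fA k1 k2 k3 P1 P2 P3 s t =
    (let a23 = dt P1 s t \<bullet> P2 s t; a24 = dt P1 s t \<bullet> P3 s t; a34 = dt P2 s t \<bullet> P3 s t in
      (fP k1 k2 k3 s t * k3 s t - fS k1 k2 k3 s t * k1 s t) * a24
    + (fP k1 k2 k3 s t * k2 s t - fR k1 k2 k3 s t * k1 s t) * a23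
    + (fR k1 k2 k3 s t * k3 s t - fS k1 k2 k3 s t * k2 s t) * a34
    - fR k1 k2 k3 s t * dt k2 s t - fS k1 k2 k3 s t * dt k3 s t - fP k1 k2 k3 s t * dt k1 s t)"

definition normal1 ::
  "(real \<Rightarrow> real \<Rightarrow> real) \<Rightarrow> (real \<Rightarrow> real \<Rightarrow> real) \<Rightarrow> (real \<Rightarrow> real \<Rightarrow> real) \<Rightarrow>
   (real \<Rightarrow> real \<Rightarrow> real^4) \<Rightarrow> (real \<Rightarrow> real \<Rightarrow> real^4) \<Rightarrow> (real \<Rightarrow> real \<Rightarrow> real^4) \<Rightarrow> real \<Rightarrow> real \<Rightarrow> real^4"
  where "normal1 k1 k2 k3 P1 P2 P3 s t =
    (1 / fQ k1 k2 k3 s t) *\<^sub>R (k1 s t *\<^sub>R P1 s t + k2 s t *\<^sub>R P2 s t + k3 s t *\<^sub>R P3 s t)"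

definition normal2 ::
  "(real \<Rightarrow> real \<Rightarrow> real) \<Rightarrow> (real \<Rightarrow> real \<Rightarrow> real) \<Rightarrow> (real \<Rightarrow> real \<Rightarrow> real) \<Rightarrow>
   (real \<Rightarrow> real \<Rightarrow> real^4) \<Rightarrow> (real \<Rightarrow> real \<Rightarrow> real^4) \<Rightarrow> (real \<Rightarrow> real \<Rightarrow> real^4) \<Rightarrow> real \<Rightarrow> real \<Rightarrow> real^4"
  where "normal2 k1 k2 k3 P1 P2 P3 s t =
    (1 / (fQ k1 k2 k3 s t * fW k1 k2 k3 s t)) *\<^sub>R
      ((k2 s t * fS k1 k2 k3 s t - k3 s t * fR k1 k2 k3 s t) *\<^sub>R P1 s t
     + (k3 s t * fP k1 k2 k3 s t - k1 s t * fS k1 k2 k3 s t) *\<^sub>R P2 s t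
     + (k1 s t * fR k1 k2 k3 s t - k2 s t * fP k1 k2 k3 s t) *\<^sub>R P3 s t)"

text \<open>
  Gaussian torsion (normal curvature) of a surface with respect to an orthonormal normal frame
  \<open>N1\<close>, \<open>N2\<close>. The area element is that of the first fundamental form; that it equals
  \<open>\<surd>(P\<^sup>2 + R\<^sup>2 + S\<^sup>2)\<close> is special to solutions of the Betchov-Da Rios equation.
\<close>

definition gaussian_torsion ::
  "(real \<Rightarrow> real \<Rightarrow> real^4) \<Rightarrow> (real \<Rightarrow> real \<Rightarrow> real^4) \<Rightarrow> (real \<Rightarrow> real \<Rightarrow> real^4) \<Rightarrow> real \<Rightarrow> real \<Rightarrow> real"
  where "gaussian_torsion \<Psi> N1 N2 s t =
    (let g11 = ds \<Psi> s t \<bullet> ds \<Psi> s t;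
         g12 = ds \<Psi> s t \<bullet> dt \<Psi> s t;
         g22 = dt \<Psi> s t \<bullet> dt \<Psi> s t;
         \<Psi>ss = ds (ds \<Psi>) s t;
         \<Psi>st = dt (ds \<Psi>) s t;
         \<Psi>tt = dt (dt \<Psi>) s t;
         c11_1 = \<Psi>ss \<bullet> N1 s t; c11_2 = \<Psi>ss \<bullet> N2 s t;
         c12_1 = \<Psi>st \<bullet> N1 s t; c12_2 = \<Psi>st \<bullet> N2 s t;
         c22_1 = \<Psi>tt \<bullet> N1 s t; c22_2 = \<Psi>tt \<bullet> N2 s t
     in (g11 * (c12_1 * c22_2 - c12_2 * c22_1)
       - g12 * (c11_1 * c22_2 - c11_2 * c22_1)
       + g22 * (c11_1 * c12_2 - c11_2 * c12_1))
       / (sqrt (g11 * g22 - g12\<^sup>2)) ^ 3)"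

end

theory Submission
  imports Defs
begin

text \<open>
  In the parallel frame the flow reads \<open>\<Psi>\<^sub>t = P P\<^sub>1 + R P\<^sub>2 + S P\<^sub>3\<close>, i.e. \<open>\<Psi>\<^sub>t\<close> has the
  coordinates of \<open>k' \<times> k\<close>; it is orthogonal to \<open>\<Psi>\<^sub>s\<close>, \<open>\<Psi>\<^sub>s\<^sub>s\<close> and \<open>\<Psi>\<^sub>s\<^sub>s\<^sub>s\<close>. Differentiating
  \<open>\<langle>\<Psi>\<^sub>t, \<Psi>\<^sub>s\<^sub>s\<rangle> = 0\<close> in \<open>s\<close> gives \<open>\<langle>\<Psi>\<^sub>s\<^sub>t, \<Psi>\<^sub>s\<^sub>s\<rangle> = 0\<close>, and in \<open>t\<close> it gives
  \<open>\<langle>\<Psi>\<^sub>t\<^sub>t, \<Psi>\<^sub>s\<^sub>s\<rangle> = \<A>\<close>. As \<open>\<Psi>\<^sub>s\<^sub>s = Q N\<^sub>1\<close>, the first normal contributes \<open>c\<^sub>1\<^sub>1 = Q\<close>,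
  \<open>c\<^sub>1\<^sub>2 = 0\<close>, \<open>c\<^sub>2\<^sub>2 = \<A> / Q\<close>. The second one contributes \<open>c\<^sub>1\<^sub>1 = 0\<close> and \<open>c\<^sub>1\<^sub>2 = Q \<C> / \<W>\<close>, since
  \<open>N\<^sub>2\<close> is parallel to \<open>k \<times> (k' \<times> k) = Q\<^sup>2 k' - \<langle>k, k'\<rangle> k\<close>. With \<open>g\<^sub>1\<^sub>2 = 0\<close> the coefficient
  \<open>c\<^sub>2\<^sub>2\<close> of \<open>N\<^sub>2\<close> drops out.
\<close>

section \<open>Determinants of order four and the ternary product\<close>

lemma det_4:
  "det (A::'a::comm_ring_1^4^4) =
    A$1$1 * (A$2$2 * (A$3$3 * A$4$4 - A$3$4 * A$4$3) - A$2$3 * (A$3$2 * A$4$4 - A$3$4 * A$4$2)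
           + A$2$4 * (A$3$2 * A$4$3 - A$3$3 * A$4$2))
  - A$1$2 * (A$2$1 * (A$3$3 * A$4$4 - A$3$4 * A$4$3) - A$2$3 * (A$3$1 * A$4$4 - A$3$4 * A$4$1)
           + A$2$4 * (A$3$1 * A$4$3 - A$3$3 * A$4$1))
  + A$1$3 * (A$2$1 * (A$3$2 * A$4$4 - A$3$4 * A$4$2) - A$2$2 * (A$3$1 * A$4$4 - A$3$4 * A$4$1)
           + A$2$4 * (A$3$1 * A$4$2 - A$3$2 * A$4$1))
  - A$1$4 * (A$2$1 * (A$3$2 * A$4$3 - A$3$3 * A$4$2) - A$2$2 * (A$3$1 * A$4$3 - A$3$3 * A$4$1)
           + A$2$3 * (A$3$1 * A$4$2 - A$3$2 * A$4$1))"
proof -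
  have f1234: "finite {2::4, 3, 4}" "1 \<notin> {2::4, 3, 4}"
    and f234: "finite {3::4, 4}" "2 \<notin> {3::4, 4}"
    and f34: "finite {4::4}" "3 \<notin> {4::4}"
    by auto
  show ?thesis
    \<comment> \<open>Each unfolding of \<open>sum_over_permutations_insert\<close> splits off one
      index by a transposition, until only the permutations of a singleton remain.\<close>
    unfolding det_def UNIV_4
    unfolding sum_over_permutations_insert[OF f1234]
    unfolding sum_over_permutations_insert[OF f234]
    unfolding sum_over_permutations_insert[OF f34]
    unfolding permutes_sing
    by (simp add: sign_swap_id permutation_swap_id permutation_compose sign_compose sign_id swap_id_eq)
      (simp add: algebra_simps)
qed

lemma vector_4 [simp]:
  "(vector [a, b, c, d] :: 'a::zero^4) $ 1 = a"
  "(vector [a, b, c, d] :: 'a::zero^4) $ 2 = b"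
  "(vector [a, b, c, d] :: 'a::zero^4) $ 3 = c"
  "(vector [a, b, c, d] :: 'a::zero^4) $ 4 = d"
  unfolding vector_def by simp_all

text \<open>Linearity of the determinant in its first row: pairing with \<open>w\<close> replaces
  the formal row of basis vectors by \<open>w\<close>.\<close>

lemma inner_cross4: "cross4 x y z \<bullet> w = det (vector [w, x, y, z] :: real^4^4)"
  by (simp add: cross4_def det_4 inner_vec_def sum_4 axis_def algebra_simps)

lemma cross4_orthogonal: "cross4 x y z \<bullet> x = 0" "cross4 x y z \<bullet> y = 0" "cross4 x y z \<bullet> z = 0"
  by (simp_all add: inner_cross4 det_4 algebra_simps)

section \<open>Coordinates in a positive orthonormal frame\<close>

context
  fixes u v w x :: "real^4"
  assumes orth: "positive_orthonormal u v w x"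
begin

lemma frame_inner:
  "u \<bullet> u = 1" "v \<bullet> v = 1" "w \<bullet> w = 1" "x \<bullet> x = 1"
  "u \<bullet> v = 0" "u \<bullet> w = 0" "u \<bullet> x = 0" "v \<bullet> w = 0" "v \<bullet> x = 0" "w \<bullet> x = 0"
  "v \<bullet> u = 0" "w \<bullet> u = 0" "x \<bullet> u = 0" "w \<bullet> v = 0" "x \<bullet> v = 0" "x \<bullet> w = 0"
  using orth unfolding positive_orthonormal_def by (auto simp: norm_eq_1 inner_commute)

text \<open>Orthonormal rows give \<open>A ** transpose A = mat 1\<close>, and a right inverse of a
  square matrix is a left inverse. Hence the determinant squares to 1, and the orientation selects
  the sign.\<close>

lemma frame_matrix:
  fixes A :: "real^4^4"
  defines "A \<equiv> vector [u, v, w, x]"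
  shows "transpose A ** A = mat 1" "det A = 1"
proof -
  \<comment> \<open>Folding \<open>inner_vec_def\<close> turns the entries of the product into inner
    products of frame vectors.\<close>
  have 1: "A ** transpose A = mat 1"
    by (simp add: A_def vec_eq_iff matrix_matrix_mult_def transpose_def forall_4 mat_def
        flip: inner_vec_def[where 'a=real, simplified inner_real_def]) (simp add: frame_inner)
  then show "transpose A ** A = mat 1"
    using matrix_left_right_inverse by blast
  have "det A * det A = 1"
    using arg_cong[OF 1, of det] by (simp add: det_mul)
  moreover have "det A > 0"
    using orth by (simp add: A_def positive_orthonormal_def)
  ultimately show "det A = 1"
    by (metis abs_of_pos power2_eq_square real_sqrt_abs real_sqrt_one)
qed

lemma frame_parseval:
  "y \<bullet> z = (y \<bullet> u) * (z \<bullet> u) + (y \<bullet> v) * (z \<bullet> v) + (y \<bullet> w) * (z \<bullet> w) + (y \<bullet> x) * (z \<bullet> x)"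
proof -
  define A :: "real^4^4" where "A = vector [u, v, w, x]"
  have A: "A *v a = vector [a \<bullet> u, a \<bullet> v, a \<bullet> w, a \<bullet> x]" for a
    by (simp add: vec_eq_iff forall_4 A_def matrix_vector_mult_def inner_vec_def mult.commute)
  have "y \<bullet> z = y \<bullet> (transpose A *v (A *v z))"
    using frame_matrix(1) by (simp add: matrix_vector_mul_assoc A_def)
  also have "\<dots> = (A *v y) \<bullet> (A *v z)"
    by (metis dot_lmul_matrix vector_transpose_matrix transpose_matrix_vector inner_commute)
  finally show ?thesis
    by (simp add: A inner_vec_def sum_4)
qed

text \<open>Passing to frame coordinates multiplies on the right by the transposed frame matrix,
  whose determinant is 1.\<close>

lemma det_frame:
  "det (vector [a, b, c, d] :: real^4^4) =
   det (vector [vector [a \<bullet> u, a \<bullet> v, a \<bullet> w, a \<bullet> x], vector [b \<bullet> u, b \<bullet> v, b \<bullet> w, b \<bullet> x],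
                vector [c \<bullet> u, c \<bullet> v, c \<bullet> w, c \<bullet> x], vector [d \<bullet> u, d \<bullet> v, d \<bullet> w, d \<bullet> x]] :: real^4^4)"
  (is "det ?B = det ?C")
proof -
  have "?C = ?B ** transpose (vector [u, v, w, x])"
    by (simp add: vec_eq_iff forall_4 matrix_matrix_mult_def transpose_def inner_vec_def)
  then show ?thesis
    by (simp add: det_mul frame_matrix)
qed

text \<open>In frame coordinates \<open>u\<close> is the first basis vector, so the ternary product
  reduces to the ordinary cross product in the span of \<open>v\<close>, \<open>w\<close>,
  \<open>x\<close>, in the order \<open>c\<close> times \<open>b\<close>.\<close>

lemma cross4_frame:
  "cross4 u b c \<bullet> v = (b \<bullet> x) * (c \<bullet> w) - (b \<bullet> w) * (c \<bullet> x)"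
  "cross4 u b c \<bullet> w = (b \<bullet> v) * (c \<bullet> x) - (b \<bullet> x) * (c \<bullet> v)"
  "cross4 u b c \<bullet> x = (b \<bullet> w) * (c \<bullet> v) - (b \<bullet> v) * (c \<bullet> w)"
proof -
  note expand = det_4 vector_4 frame_inner
  show "cross4 u b c \<bullet> v = (b \<bullet> x) * (c \<bullet> w) - (b \<bullet> w) * (c \<bullet> x)"
    unfolding inner_cross4 by (subst det_frame) (simp add: expand)
  show "cross4 u b c \<bullet> w = (b \<bullet> v) * (c \<bullet> x) - (b \<bullet> x) * (c \<bullet> v)"
    unfolding inner_cross4 by (subst det_frame) (simp add: expand)
  show "cross4 u b c \<bullet> x = (b \<bullet> w) * (c \<bullet> v) - (b \<bullet> v) * (c \<bullet> w)"
    unfolding inner_cross4 by (subst det_frame) (simp add: expand)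
qed

end

section \<open>Calculus of partial derivatives\<close>

text \<open>The product rule for a function \<open>f\<close> that is known to be an inner product
  only on the open domain; differentiability of \<open>f\<close> comes out of that
  representation.\<close>

lemma ds_inner:
  fixes f :: "real \<Rightarrow> real \<Rightarrow> real" and a b :: "real \<Rightarrow> real \<Rightarrow> 'a::real_inner"
  assumes "open I" "s \<in> I"
    and "(\<lambda>x. a x t) differentiable (at s)" "(\<lambda>x. b x t) differentiable (at s)"
    and "\<And>x. x \<in> I \<Longrightarrow> f x t = a x t \<bullet> b x t"
  shows "ds f s t = ds a s t \<bullet> b s t + a s t \<bullet> ds b s t"
proof -
  have "((\<lambda>x. a x t \<bullet> b x t) has_vector_derivative a s t \<bullet> ds b s t + ds a s t \<bullet> b s t) (at s)"
    using assms unfolding ds_def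
    by (intro bounded_bilinear.has_vector_derivative[OF bounded_bilinear_inner])
      (auto simp: vector_derivative_works[symmetric])
  then have "((\<lambda>x. f x t) has_vector_derivative a s t \<bullet> ds b s t + ds a s t \<bullet> b s t) (at s)"
    by (rule has_vector_derivative_transform_within_open) (use assms in auto)
  then show ?thesis
    by (simp add: ds_def[of f] vector_derivative_at)
qed

lemma dt_inner:
  fixes f :: "real \<Rightarrow> real \<Rightarrow> real" and a b :: "real \<Rightarrow> real \<Rightarrow> 'a::real_inner"
  assumes "open J" "t \<in> J"
    and "(\<lambda>y. a s y) differentiable (at t)" "(\<lambda>y. b s y) differentiable (at t)"
    and "\<And>y. y \<in> J \<Longrightarrow> f s y = a s y \<bullet> b s y"
  shows "dt f s t = dt a s t \<bullet> b s t + a s t \<bullet> dt b s t"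
  using ds_inner[of J t "\<lambda>y s. a s y" s "\<lambda>y s. b s y" "\<lambda>y s. f s y"] assms
  by (simp add: ds_def dt_def)

lemma ds_cong:
  assumes "open I" "s \<in> I" "\<And>x. x \<in> I \<Longrightarrow> f x t = g x t"
  shows "ds f s t = ds g s t"
  unfolding ds_def
  using assms by (intro vector_derivative_cong_eq) (auto simp: eventually_nhds)

lemma Ck_on_ds: "Ck_on (Suc n) U f \<Longrightarrow> Ck_on n U (ds f)"
  and Ck_on_dt: "Ck_on (Suc n) U f \<Longrightarrow> Ck_on n U (dt f)"
  by simp_all

lemma Ck_on_SucD:
  assumes "Ck_on (Suc n) (I \<times> J) f" "s \<in> I" "t \<in> J"
  shows "((\<lambda>x. f x t) has_vector_derivative ds f s t) (at s)"
    and "((\<lambda>y. f s y) has_vector_derivative dt f s t) (at t)"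
    and "(\<lambda>x. f x t) differentiable (at s)" "(\<lambda>y. f s y) differentiable (at t)"
  using assms by (auto simp: ds_def dt_def vector_derivative_works[symmetric])

text \<open>
  Differentiating \<open>f x y = f x a + \<integral>\<^sub>a\<^sup>y f\<^sub>t x \<tau> d\<tau>\<close> under the integral sign in \<open>x\<close> and then in \<open>y\<close>
  needs the continuity of \<open>f\<^sub>t\<^sub>s\<close> only.
\<close>
lemma dt_ds_commute:
  fixes f :: "real \<Rightarrow> real \<Rightarrow> 'a::banach"
  assumes "open I" "open J" and Ck: "Ck_on 2 (I \<times> J) f" and "s \<in> I" "t \<in> J"
  shows "dt (ds f) s t = ds (dt f) s t"
proof -
  obtain d where d: "d > 0" "ball s d \<subseteq> I"
    using \<open>open I\<close> \<open>s \<in> I\<close> openE by blast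
  obtain e where e: "e > 0" "cball t e \<subseteq> J"
    using \<open>open J\<close> \<open>t \<in> J\<close> open_contains_cball by blast
  \<comment> \<open>The Leibniz rule asks for a convex parameter set, hence a ball; the base point
    \<open>a\<close> lies strictly below \<open>t\<close>, so that \<open>t\<close> is interior to
    \<open>{a..b}\<close>.\<close>
  define U a b where "U = ball s d" and "a = t - e" and "b = t + e"
  have ab: "{a..b} \<subseteq> J" "a < t" "t < b"
    using e by (auto simp: a_def b_def cball_eq_atLeastAtMost)
  have U: "U \<subseteq> I" "s \<in> U" "open U" "convex U"
    using d by (auto simp: U_def)
  have C1: "Ck_on (Suc 1) (I \<times> J) f" and C2: "Ck_on (Suc 0) (I \<times> J) (dt f)"
    and C3: "Ck_on 0 (I \<times> J) (ds (dt f))"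
    using Ck by (simp_all add: numeral_2_eq_2)
  have cont: "continuous_on {a..b} (dt f x)" if "x \<in> U" for x
    using Ck_on_SucD(4)[OF C2] that U ab
    by (intro continuous_at_imp_continuous_on) (blast intro: differentiable_imp_continuous_within)
  have cont2: "continuous_on (U \<times> {a..b}) (\<lambda>(x, y). ds (dt f) x y)"
    using C3 U ab by (auto intro: continuous_on_subset)
  have ftc: "f x y = f x a + integral {a..y} (dt f x)" if "x \<in> U" "y \<in> {a..b}" for x y
  proof -
    have "(dt f x has_integral (f x y - f x a)) {a..y}"
    proof (rule fundamental_theorem_of_calculus)
      fix z assume "z \<in> {a..y}"
      then have "x \<in> I" "z \<in> J"
        using that U ab by auto
      then show "(f x has_vector_derivative dt f x z) (at z within {a..y})"
        by (rule has_vector_derivative_at_within[OF Ck_on_SucD(2)[OF C1]])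
    qed (use that in auto)
    then show ?thesis
      by (simp add: integral_unique)
  qed
  have ds: "ds f s y = ds f s a + integral {a..y} (ds (dt f) s)" if y: "y \<in> {a..b}" for y
  proof -
    have "((\<lambda>x. integral (cbox a y) (dt f x)) has_vector_derivative
        integral (cbox a y) (ds (dt f) s)) (at s within U)"
    proof (rule leibniz_rule_vector_derivative)
      fix x z assume "x \<in> U" "z \<in> cbox a y"
      then have "x \<in> I" "z \<in> J"
        using y U ab by auto
      then show "((\<lambda>x. dt f x z) has_vector_derivative ds (dt f) x z) (at x within U)"
        by (rule has_vector_derivative_at_within[OF Ck_on_SucD(1)[OF C2]])
    next
      fix x assume "x \<in> U"
      then show "dt f x integrable_on cbox a y"
        using y by (auto intro!: integrable_continuous_real intro: continuous_on_subset[OF cont])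
    next
      show "continuous_on (U \<times> cbox a y) (\<lambda>(x, z). ds (dt f) x z)"
        using y by (auto intro: continuous_on_subset[OF cont2])
    qed (use U in auto)
    then have "((\<lambda>x. integral {a..y} (dt f x)) has_vector_derivative
        integral {a..y} (ds (dt f) s)) (at s)"
      using U by (simp add: at_within_open[of s U])
    moreover have "((\<lambda>x. f x a) has_vector_derivative ds f s a) (at s)"
      using U ab by (intro Ck_on_SucD(1)[OF C1]) auto
    ultimately have "((\<lambda>x. f x a + integral {a..y} (dt f x)) has_vector_derivative
        ds f s a + integral {a..y} (ds (dt f) s)) (at s)"
      by (intro has_vector_derivative_add)
    then have "((\<lambda>x. f x y) has_vector_derivative ds f s a + integral {a..y} (ds (dt f) s)) (at s)"
      by (rule has_vector_derivative_transform_within_open[of _ _ _ U]) (use U y in \<open>auto simp flip: ftc\<close>)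
    then show ?thesis
      by (simp add: ds_def[of f] vector_derivative_at)
  qed
  \<comment> \<open>The \<open>case\<close> form exhibits the integrand as the uncurried function of
    \<open>cont2\<close> composed with the map from \<open>y\<close> to
    \<open>(s, y)\<close>.\<close>
  have "continuous_on {a..b} (\<lambda>y. case (s, y) of (x, y) \<Rightarrow> ds (dt f) x y)"
    by (rule continuous_on_compose2[OF cont2]) (use U in \<open>auto intro!: continuous_intros\<close>)
  then have "((\<lambda>y. integral {a..y} (ds (dt f) s)) has_vector_derivative ds (dt f) s t)
      (at t within {a..b})"
    using ab by (intro integral_has_vector_derivative) auto
  then have "((\<lambda>y. integral {a..y} (ds (dt f) s)) has_vector_derivative ds (dt f) s t) (at t)"
    using ab by (simp add: at_within_Icc_at)
  then have "((\<lambda>y. ds f s a + integral {a..y} (ds (dt f) s)) has_vector_derivative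
      0 + ds (dt f) s t) (at t)"
    by (intro has_vector_derivative_add) auto
  then have "((\<lambda>y. ds f s y) has_vector_derivative 0 + ds (dt f) s t) (at t)"
    by (rule has_vector_derivative_transform_within_open[of _ _ _ "{a<..<b}"]) (use ab in \<open>auto simp flip: ds\<close>)
  then show ?thesis
    by (simp add: dt_def[of "ds f"] vector_derivative_at)
qed

section \<open>The Gaussian torsion of the soliton surface\<close>

theorem theorem7:
  fixes I J :: "real set"
    and \<Psi> T P1 P2 P3 :: "real \<Rightarrow> real \<Rightarrow> real^4"
    and k1 k2 k3 :: "real \<Rightarrow> real \<Rightarrow> real"
  assumes "open I" "is_interval I" "I \<noteq> {}"
    and "open J" "is_interval J" "J \<noteq> {}"
    and "smooth_on2 (I \<times> J) \<Psi>"
    and "unit_speed_s (I \<times> J) \<Psi>"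
    and "parallel_transport_frame (I \<times> J) \<Psi> T P1 P2 P3 k1 k2 k3"
    and "at_least_two_nonzero (I \<times> J) k1 k2 k3"
    and "\<forall>s\<in>I. \<forall>t\<in>J. \<not> (fP k1 k2 k3 s t = 0 \<and> fR k1 k2 k3 s t = 0 \<and> fS k1 k2 k3 s t = 0)"
    and "betchov_da_rios (I \<times> J) \<Psi>"
  shows "\<forall>s\<in>I. \<forall>t\<in>J.
    gaussian_torsion \<Psi> (normal1 k1 k2 k3 P1 P2 P3) (normal2 k1 k2 k3 P1 P2 P3) s t =
      ((fQ k1 k2 k3 s t)\<^sup>2 * (fW k1 k2 k3 s t)\<^sup>2 - fA k1 k2 k3 P1 P2 P3 s t) * fC k1 k2 k3 s t
        / (fW k1 k2 k3 s t) ^ 4"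
proof (intro ballI)
  fix s t assume st: "s \<in> I" "t \<in> J"
  note frame_defs = \<open>parallel_transport_frame (I \<times> J) \<Psi> T P1 P2 P3 k1 k2 k3\<close>[unfolded parallel_transport_frame_def]
  have frame: "positive_orthonormal (T x y) (P1 x y) (P2 x y) (P3 x y)"
    and T: "ds \<Psi> x y = T x y"
    and dsT: "ds T x y = k1 x y *\<^sub>R P1 x y + k2 x y *\<^sub>R P2 x y + k3 x y *\<^sub>R P3 x y"
    and dsP: "ds P1 x y = - k1 x y *\<^sub>R T x y" "ds P2 x y = - k2 x y *\<^sub>R T x y"
      "ds P3 x y = - k3 x y *\<^sub>R T x y"
    if "x \<in> I" "y \<in> J" for x y
    using that frame_defs[THEN conjunct2, THEN conjunct2, THEN conjunct2, THEN conjunct2,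
        THEN bspec, of "(x, y)"] by auto
  note inner = frame_inner[OF frame]
  \<comment> \<open>\<open>E\<close> is \<open>\<Psi>\<^sub>s\<^sub>s\<close> on the domain and
    \<open>V\<close> is \<open>\<Psi>\<^sub>t\<close>. Taking \<open>E\<close> from \<open>T\<close>
    lets its regularity come from that of the frame.\<close>
  define E V where "E = ds T" and "V = dt \<Psi>"
  have Ck: "Ck_on (Suc 0) (I \<times> J) E" "Ck_on (Suc 0) (I \<times> J) V"
    "Ck_on (Suc 0) (I \<times> J) P1" "Ck_on (Suc 0) (I \<times> J) P2" "Ck_on (Suc 0) (I \<times> J) P3"
  proof -
    have "Ck_on (Suc (Suc 0)) (I \<times> J) T" "Ck_on (Suc (Suc 0)) (I \<times> J) \<Psi>"
      using frame_defs \<open>smooth_on2 (I \<times> J) \<Psi>\<close> unfolding smooth_on2_def by blast+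
    then show "Ck_on (Suc 0) (I \<times> J) E" "Ck_on (Suc 0) (I \<times> J) V"
      unfolding E_def V_def by (blast intro: Ck_on_ds Ck_on_dt)+
    show "Ck_on (Suc 0) (I \<times> J) P1" "Ck_on (Suc 0) (I \<times> J) P2" "Ck_on (Suc 0) (I \<times> J) P3"
      using frame_defs unfolding smooth_on2_def by blast+
  qed
  note diff = Ck[THEN Ck_on_SucD(3)] Ck[THEN Ck_on_SucD(4)]
  note D_s = ds_inner[OF \<open>open I\<close>] and D_t = dt_inner[OF \<open>open J\<close>]
  have E: "E x y \<bullet> P1 x y = k1 x y" "E x y \<bullet> P2 x y = k2 x y" "E x y \<bullet> P3 x y = k3 x y"
      "E x y \<bullet> T x y = 0" if "x \<in> I" "y \<in> J" for x y
    using that by (simp_all add: E_def dsT inner inner_add_left)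
  \<comment> \<open>The other term of the product rule is a multiple of
    \<open>E x y \<bullet> T x y\<close>, which is zero.\<close>
  have dsk: "ds k1 x y = ds E x y \<bullet> P1 x y" "ds k2 x y = ds E x y \<bullet> P2 x y"
      "ds k3 x y = ds E x y \<bullet> P3 x y" if "x \<in> I" "y \<in> J" for x y
    using that D_s[of x E y P1 k1] D_s[of x E y P2 k2] D_s[of x E y P3 k3]
    by (simp_all add: diff E dsP)
  have dsds: "ds (ds \<Psi>) x y = E x y" if "x \<in> I" "y \<in> J" for x y
    unfolding E_def using that by (intro ds_cong[OF \<open>open I\<close>]) (auto simp: T)
  have dsdsds: "ds (ds (ds \<Psi>)) x y = ds E x y" if "x \<in> I" "y \<in> J" for x y
    using that by (intro ds_cong[OF \<open>open I\<close>]) (auto simp: dsds)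
  have V_cross: "V x y = cross4 (T x y) (E x y) (ds E x y)" if "x \<in> I" "y \<in> J" for x y
    using \<open>betchov_da_rios (I \<times> J) \<Psi>\<close> that
    by (auto simp: betchov_da_rios_def V_def T dsds dsdsds)
  have V: "V x y \<bullet> T x y = 0" "V x y \<bullet> E x y = 0" "V x y \<bullet> ds E x y = 0"
      "V x y \<bullet> P1 x y = fP k1 k2 k3 x y" "V x y \<bullet> P2 x y = fR k1 k2 k3 x y"
      "V x y \<bullet> P3 x y = fS k1 k2 k3 x y" if "x \<in> I" "y \<in> J" for x y
    using that by (simp_all add: V_cross cross4_orthogonal cross4_frame[OF frame] E dsk
        fP_def fR_def fS_def)
  \<comment> \<open>Again the derivatives of the \<open>P\<close>-fields are multiples of
    \<open>T\<close>, here orthogonal to \<open>V\<close>.\<close>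
  have dsV: "ds (fP k1 k2 k3) s t = ds V s t \<bullet> P1 s t" "ds (fR k1 k2 k3) s t = ds V s t \<bullet> P2 s t"
      "ds (fS k1 k2 k3) s t = ds V s t \<bullet> P3 s t"
    using st D_s[of s V t P1 "fP k1 k2 k3"] D_s[of s V t P2 "fR k1 k2 k3"]
      D_s[of s V t P3 "fS k1 k2 k3"]
    by (simp_all add: diff V dsP)
  have dsV_E: "ds V s t \<bullet> E s t = 0"
    using st D_s[of s V t E "\<lambda>_ _. 0"] by (simp add: diff V ds_def[of "\<lambda>_ _. 0"])
  have dtV_E: "dt V s t \<bullet> E s t = - (V s t \<bullet> dt E s t)"
    using st D_t[of t V s E "\<lambda>_ _. 0"] by (simp add: diff V dt_def[of "\<lambda>_ _. 0"])
  have dtE: "dt E s t \<bullet> P1 s t = dt k1 s t - E s t \<bullet> dt P1 s t"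
      "dt E s t \<bullet> P2 s t = dt k2 s t - E s t \<bullet> dt P2 s t"
      "dt E s t \<bullet> P3 s t = dt k3 s t - E s t \<bullet> dt P3 s t"
    using st D_t[of t E s P1 k1] D_t[of t E s P2 k2] D_t[of t E s P3 k3]
    by (simp_all add: diff E)
  \<comment> \<open>Differentiating the orthonormality relations in \<open>t\<close> leaves the
    three independent coefficients that enter \<open>fA\<close>.\<close>
  have skew: "P1 s t \<bullet> dt P1 s t = 0" "P2 s t \<bullet> dt P2 s t = 0" "P3 s t \<bullet> dt P3 s t = 0"
      "P1 s t \<bullet> dt P2 s t = - (P2 s t \<bullet> dt P1 s t)" "P1 s t \<bullet> dt P3 s t = - (P3 s t \<bullet> dt P1 s t)"
      "P2 s t \<bullet> dt P3 s t = - (P3 s t \<bullet> dt P2 s t)"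
    using st D_t[of t P1 s P1 "\<lambda>_ _. 1"] D_t[of t P2 s P2 "\<lambda>_ _. 1"] D_t[of t P3 s P3 "\<lambda>_ _. 1"]
      D_t[of t P1 s P2 "\<lambda>_ _. 0"] D_t[of t P1 s P3 "\<lambda>_ _. 0"] D_t[of t P2 s P3 "\<lambda>_ _. 0"]
    by (simp_all add: diff inner dt_def[of "\<lambda>_ _. _"] inner_commute)

  \<comment> \<open>The letter \<open>q\<close> stands for \<open>fS\<close>, not for
    \<open>fQ\<close>.\<close>
  define p r q where "p = fP k1 k2 k3 s t" and "r = fR k1 k2 k3 s t" and "q = fS k1 k2 k3 s t"
  define Q W where "Q = fQ k1 k2 k3 s t" and "W = fW k1 k2 k3 s t"
  define A C where "A = fA k1 k2 k3 P1 P2 P3 s t" and "C = fC k1 k2 k3 s t"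
  define N1 N2 where "N1 = normal1 k1 k2 k3 P1 P2 P3 s t" and "N2 = normal2 k1 k2 k3 P1 P2 P3 s t"
  have A: "dt V s t \<bullet> E s t = A"
  proof -
    have E_eq: "E s t = k1 s t *\<^sub>R P1 s t + k2 s t *\<^sub>R P2 s t + k3 s t *\<^sub>R P3 s t"
      using st by (simp add: E_def dsT)
    \<comment> \<open>The \<open>T\<close>-coordinate is absent because \<open>V\<close> is
      orthogonal to \<open>T\<close>.\<close>
    have "V s t \<bullet> dt E s t = p * (dt E s t \<bullet> P1 s t) + r * (dt E s t \<bullet> P2 s t) + q * (dt E s t \<bullet> P3 s t)"
      using st by (simp add: frame_parseval[OF frame, of s t "V s t"] V p_def r_def q_def)
    also have "\<dots> = - A"
      unfolding dtE
      by (simp add: E_eq A_def fA_def Let_def inner_add_left skew p_def r_def q_def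
          inner_commute[of "dt _ s t" "_ s t"] algebra_simps)
    finally show ?thesis
      by (simp add: dtV_E)
  qed
  have prq: "p = k3 s t * ds k2 s t - k2 s t * ds k3 s t" "r = k1 s t * ds k3 s t - k3 s t * ds k1 s t"
      "q = k2 s t * ds k1 s t - k1 s t * ds k2 s t"
    by (simp_all add: p_def r_def q_def fP_def fR_def fS_def)
  have "p \<noteq> 0 \<or> r \<noteq> 0 \<or> q \<noteq> 0"
    using assms(11) st by (auto simp: p_def r_def q_def)
  \<comment> \<open>\<open>p\<close>, \<open>r\<close>, \<open>q\<close> are linear in the values of
    the curvatures, so they would all vanish together with these; hence
    \<open>Q > 0\<close>.\<close>
  moreover from this have "k1 s t \<noteq> 0 \<or> k2 s t \<noteq> 0 \<or> k3 s t \<noteq> 0"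
    by (auto simp: prq)
  moreover have "a\<^sup>2 + b\<^sup>2 + c\<^sup>2 > 0" if "a \<noteq> 0 \<or> b \<noteq> 0 \<or> c \<noteq> 0" for a b c :: real
    using that by (smt (verit) zero_le_power2 zero_less_power2)
  ultimately have pos: "(k1 s t)\<^sup>2 + (k2 s t)\<^sup>2 + (k3 s t)\<^sup>2 > 0" "p\<^sup>2 + r\<^sup>2 + q\<^sup>2 > 0"
    by blast+
  have Q: "Q > 0" "Q\<^sup>2 = (k1 s t)\<^sup>2 + (k2 s t)\<^sup>2 + (k3 s t)\<^sup>2"
    using pos by (simp_all add: Q_def fQ_def)
  have W: "W > 0" "W\<^sup>2 = p\<^sup>2 + r\<^sup>2 + q\<^sup>2"
    using pos by (simp_all add: W_def fW_def p_def r_def q_def)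
  have g22: "V s t \<bullet> V s t = W\<^sup>2"
    using st unfolding W(2) by (simp add: frame_parseval[OF frame, of s t "V s t"] V p_def r_def q_def power2_eq_square)
  have N1: "N1 = (1 / Q) *\<^sub>R E s t"
    using st by (simp add: N1_def normal1_def Q_def E_def dsT)
  have N2: "z \<bullet> N2 = ((k2 s t * q - k3 s t * r) * (z \<bullet> P1 s t) + (k3 s t * p - k1 s t * q) * (z \<bullet> P2 s t)
      + (k1 s t * r - k2 s t * p) * (z \<bullet> P3 s t)) / (Q * W)" for z
    by (simp add: N2_def normal2_def Q_def W_def p_def q_def r_def inner_add_right divide_simps)
  have EE: "E s t \<bullet> E s t = Q\<^sup>2"
    using st unfolding Q(2) by (simp add: frame_parseval[OF frame, of s t "E s t"] E power2_eq_square)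
  \<comment> \<open>The coordinates of \<open>N2\<close> are proportional to the cross product of
    those of \<open>E\<close> and \<open>V\<close>, hence orthogonal to those of
    \<open>E\<close>.\<close>
  have c11: "E s t \<bullet> N1 = Q" "E s t \<bullet> N2 = 0"
    using st Q(1) by (simp_all add: N1 EE N2 E power2_eq_square algebra_simps)
  have c12_1: "ds V s t \<bullet> N1 = 0"
    by (simp add: N1 dsV_E)
  have c22_1: "dt V s t \<bullet> N1 = A / Q"
    by (simp add: N1 A)
  have c12_2: "ds V s t \<bullet> N2 = Q * C / W"
  proof -
    define p' r' q' where "p' = ds V s t \<bullet> P1 s t" and "r' = ds V s t \<bullet> P2 s t" and "q' = ds V s t \<bullet> P3 s t"
    have C: "C = ds k1 s t * p' + ds k2 s t * r' + ds k3 s t * q'"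
      by (simp add: C_def fC_def dsV p'_def r'_def q'_def)
    have orth: "k1 s t * p' + k2 s t * r' + k3 s t * q' = 0"
      using dsV_E st by (simp add: E_def dsT inner_add_right p'_def r'_def q'_def)
    \<comment> \<open>The triple product identity for \<open>N2\<close>, paired with the coordinates
      of \<open>ds V\<close>; its last term vanishes by \<open>orth\<close>.\<close>
    have "(k2 s t * q - k3 s t * r) * p' + (k3 s t * p - k1 s t * q) * r' + (k1 s t * r - k2 s t * p) * q'
        = Q\<^sup>2 * C - (k1 s t * p' + k2 s t * r' + k3 s t * q')
            * (k1 s t * ds k1 s t + k2 s t * ds k2 s t + k3 s t * ds k3 s t)"
      unfolding prq Q(2) C by (simp add: algebra_simps power2_eq_square)
    then show ?thesis
      using Q(1) W(1) by (simp add: N2 orth flip: p'_def r'_def q'_def) (simp add: power2_eq_square)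
  qed
  \<comment> \<open>The mixed derivative in the torsion is \<open>dt (ds \<Psi>)\<close>, while the
    coefficients above were found for \<open>ds V\<close>.\<close>
  have "dt (ds \<Psi>) s t = ds V s t"
    unfolding V_def using \<open>smooth_on2 (I \<times> J) \<Psi>\<close> st \<open>open I\<close> \<open>open J\<close>
    by (intro dt_ds_commute[of I J]) (auto simp: smooth_on2_def)
  \<comment> \<open>Here \<open>g11 = 1\<close>, \<open>g12 = 0\<close>, and the area element is the
    root of \<open>W\<^sup>2\<close>, which is \<open>W\<close> by positivity. The product
    \<open>dt V s t \<bullet> N2\<close> needs no value: it is multiplied by
    \<open>c12_1 = 0\<close> and by \<open>g12 = 0\<close>.\<close>
  then have "gaussian_torsion \<Psi> (normal1 k1 k2 k3 P1 P2 P3) (normal2 k1 k2 k3 P1 P2 P3) s t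
      = (- (Q * C / W) * (A / Q) + W\<^sup>2 * (Q * (Q * C / W))) / W ^ 3"
    using st W(1) V(1)[of s t]
    by (simp add: gaussian_torsion_def Let_def T dsds inner inner_commute[of "T s t" "V s t"] g22
        c11 c12_1 c12_2 c22_1 flip: V_def N1_def N2_def)
  also have "\<dots> = (Q\<^sup>2 * W\<^sup>2 - A) * C / W ^ 4"
    using Q(1) W(1) by (simp add: field_simps power2_eq_square power3_eq_cube power4_eq_xxxx)
  finally show "gaussian_torsion \<Psi> (normal1 k1 k2 k3 P1 P2 P3) (normal2 k1 k2 k3 P1 P2 P3) s t =
      ((fQ k1 k2 k3 s t)\<^sup>2 * (fW k1 k2 k3 s t)\<^sup>2 - fA k1 k2 k3 P1 P2 P3 s t) * fC k1 k2 k3 s t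
        / (fW k1 k2 k3 s t) ^ 4"
    by (simp add: Q_def W_def A_def C_def)
qed

end
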